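(* Let $(\Omega,\rho)$ be a compact path-connected metric space with diameter $\operatorname{diam}(\Omega)=\max_{x,y\in\Omega}\rho(x,y)=\pi$. Let $\mu$ be a non-atomic Borel probability measure on $\Omega$ and let $N\ge 2$ be an integer. Assume that for some $\delta>0$, $$\inf_{x\in\Omega}\mu\bigl(B_{\delta/2}(x)\bigr)\ge \frac1N .$$ Then there exists a partition $\{R_1,\dots,R_N\}$ of $\Omega$ such that: (i) the $R_j$ are pairwise disjoint subsets of $\Omega$; (ii) for each $1\le j\le N$, $\mu(R_j)=\frac1N$ and $\operatorname{diam}(R_j)\le 4\delta$.
   Context: $B_\zeta(x)=\{y\in\Omega:\rho(x,y)<\zeta\}$ is the open ball. A partition of $\Omega$ is a finite collection of pairwise disjoint (measurable) subsets whose union is $\Omega$. Path-connected means any two points are joined by a continuous map $\gamma:[0,1]\to\Omega$. *)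

theory Defs
  imports "HOL-Probability.Probability"
begin

definition measure_atom :: "'a measure \<Rightarrow> 'a set \<Rightarrow> bool" where
  "measure_atom M A \<longleftrightarrow>
     A \<in> sets M \<and> emeasure M A > 0 \<and>
     (\<forall>B\<in>sets M. B \<subseteq> A \<and> emeasure M B < emeasure M A \<longrightarrow> emeasure M B = 0)"

definition nonatomic :: "'a measure \<Rightarrow> bool" where
  "nonatomic M \<longleftrightarrow> (\<nexists>A. measure_atom M A)"

text \<open>The underlying space is the subset \<open>\<Omega>\<close>, so balls are taken relative to it.\<close>

definition rel_ball :: "'a::metric_space set \<Rightarrow> 'a \<Rightarrow> real \<Rightarrow> 'a set" where
  "rel_ball \<Omega> x r = {y\<in>\<Omega>. dist x y < r}"

definition measurable_partition :: "'a measure \<Rightarrow> 'i set \<Rightarrow> ('i \<Rightarrow> 'a set) \<Rightarrow> bool" where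
  "measurable_partition M I R \<longleftrightarrow>
     finite I \<and> (\<forall>i\<in>I. R i \<in> sets M) \<and> disjoint_family_on R I \<and> (\<Union>i\<in>I. R i) = space M"

end

theory Submission
  imports Defs
begin

text \<open>
  Choose points \<open>x\<^sub>0, x\<^sub>1, \<dots>\<close> greedily, each at distance exactly \<open>\<delta>\<close> from the set of its
  predecessors; connectedness allows this until the open \<open>\<delta>\<close>-balls cover the space. Every point then
  has a parent among its predecessors at distance exactly \<open>\<delta>\<close>, and the disjoint balls of radius
  \<open>\<delta>/2\<close> extend to a partition into cells \<open>V\<^sub>k\<close> of radius at most \<open>\<delta>\<close> and mass at least \<open>1/N\<close>.
  From the last node down to the root, cut what lies at \<open>k\<close> into pieces of mass \<open>1/N\<close>,
  leaving a remainder of mass less than \<open>1/N\<close> that is taken inside \<open>V\<^sub>k\<close> and handed to the parent of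
  \<open>k\<close>. A remainder travels along one edge only, so every piece stays within \<open>2\<delta>\<close> of some \<open>x\<^sub>k\<close>.
\<close>

section \<open>Values of a non-atomic finite measure\<close>

text \<open>A set of positive measure that is not an atom splits into two parts of positive measure,
  the lighter of which has at most half the mass. Halving repeatedly gets below any
  \<open>e\<close>.\<close>

lemma (in finite_measure) nonatomic_small_subset:
  assumes na: "nonatomic M" and A: "A \<in> sets M" "measure M A > 0" and e: "e > 0"
  shows "\<exists>B\<in>sets M. B \<subseteq> A \<and> 0 < measure M B \<and> measure M B \<le> e"
proof -
  have half: "\<exists>B\<in>sets M. B \<subseteq> C \<and> 0 < measure M B \<and> measure M B \<le> measure M C / 2"
    if C: "C \<in> sets M" "measure M C > 0" for C
  proof -
    have "\<not> measure_atom M C" using na by (auto simp: nonatomic_def)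
    then obtain B where B: "B \<in> sets M" "B \<subseteq> C" "emeasure M B < emeasure M C" "emeasure M B \<noteq> 0"
      using C unfolding measure_atom_def by (auto simp: emeasure_eq_measure)
    have pos: "0 < measure M B" and less: "measure M B < measure M C"
      using B C by (auto simp: emeasure_eq_measure less_le)
    have diff: "measure M (C - B) = measure M C - measure M B"
      using B C by (intro finite_measure_Diff) auto
    show ?thesis
    proof (cases "measure M B \<le> measure M C / 2")
      case True then show ?thesis using B pos by blast
    next
      case False
      then show ?thesis using B C diff less by (intro bexI[of _ "C - B"]) auto
    qed
  qed
  have iter: "\<exists>B\<in>sets M. B \<subseteq> A \<and> 0 < measure M B \<and> measure M B \<le> measure M A / 2 ^ n" for n
  proof (induction n)
    case 0 then show ?case using A by auto
  next
    case (Suc n)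
    then obtain B where B: "B \<in> sets M" "B \<subseteq> A" "0 < measure M B" "measure M B \<le> measure M A / 2 ^ n"
      by auto
    from half[OF B(1,3)] obtain D where
      D: "D \<in> sets M" "D \<subseteq> B" "0 < measure M D" "measure M D \<le> measure M B / 2" by auto
    have "measure M D \<le> measure M A / 2 ^ Suc n"
      using order_trans[OF D(4) divide_right_mono[OF B(4), of 2]] by (simp add: mult.commute)
    then show ?case using B D by blast
  qed
  obtain n where "measure M A / e < 2 ^ n"
    using real_arch_pow[of 2 "measure M A / e"] by auto
  then have "measure M A / 2 ^ n \<le> e"
    using e by (simp add: field_simps)
  then show ?thesis using iter[of n] by (meson order_trans)
qed

text \<open>Sierpinski's theorem on the range of a non-atomic measure, by greedy exhaustion from
  inside: each step adds a set that is nearly as large as the remaining mass allows. The increments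
  tend to 0, so at the limit no further set of positive measure could be added, whereas the previous
  lemma supplies one as long as \<open>t\<close> has not been reached.\<close>

lemma (in finite_measure) nonatomic_subset_of_measure:
  assumes na: "nonatomic M" and A: "A \<in> sets M" and t: "0 \<le> t" "t \<le> measure M A"
  obtains B where "B \<in> sets M" "B \<subseteq> A" "measure M B = t"
proof -
  \<comment> \<open>\<open>F B\<close> collects the sets that can be added to \<open>B\<close>
    without leaving \<open>A\<close> or exceeding \<open>t\<close>.\<close>
  define F where "F B = {C \<in> sets M. C \<subseteq> A - B \<and> measure M C \<le> t - measure M B}" for B
  let ?P = "\<lambda>B. B \<in> sets M \<and> B \<subseteq> A \<and> measure M B \<le> t"
  \<comment> \<open>The supremum over \<open>F B\<close> need not be attained; the factor 2 asks
    only for an increment of at least half of it. If the supremum is 0, \<open>B' = B\<close> will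
    do.\<close>
  let ?Q = "\<lambda>B B'. B \<subseteq> B' \<and> (\<forall>C\<in>F B. measure M C \<le> 2 * (measure M B' - measure M B))"
  have step: "\<exists>B'. ?P B' \<and> ?Q B B'" if B: "?P B" for B
  proof -
    define s where "s = (SUP C\<in>F B. measure M C)"
    have ne: "F B \<noteq> {}" using B by (auto simp: F_def intro!: exI[of _ "{}"])
    have bdd: "bdd_above (measure M ` F B)"
      by (rule bdd_aboveI[of _ "t - measure M B"]) (auto simp: F_def)
    have up: "measure M C \<le> s" if "C \<in> F B" for C
      unfolding s_def using that bdd by (rule cSUP_upper)
    show ?thesis
    proof (cases "s \<le> 0")
      case True
      then have "measure M C \<le> 2 * (measure M B - measure M B)" if "C \<in> F B" for C
        using order_trans[OF up[OF that] True] by simp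
      then show ?thesis using B by blast
    next
      case False
      then have "s / 2 < s" by simp
      then obtain C where C: "C \<in> F B" "s / 2 < measure M C"
        using less_cSUP_iff[OF ne bdd, of "s / 2"] unfolding s_def by blast
      have un: "measure M (B \<union> C) = measure M B + measure M C"
        using B C by (intro finite_measure_Union) (auto simp: F_def)
      have "measure M D \<le> 2 * (measure M (B \<union> C) - measure M B)" if "D \<in> F B" for D
        unfolding un using up[OF that] C(2) by simp
      moreover have "?P (B \<union> C)"
        using B C un by (auto simp: F_def)
      ultimately show ?thesis by blast
    qed
  qed
  have "\<exists>f. \<forall>n. ?P (f n) \<and> ?Q (f n) (f (Suc n))"
  proof (rule dependent_nat_choice)
    show "\<exists>B. ?P B" using t by (intro exI[of _ "{}"]) auto
  qed (rule step)
  then obtain f where f: "\<And>n. ?P (f n)" "\<And>n. ?Q (f n) (f (Suc n))" by blast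
  let ?B = "\<Union>n. f n"
  have inc: "incseq f" using f(2) by (intro incseq_SucI) auto
  have lim: "(\<lambda>n. measure M (f n)) \<longlonglongrightarrow> measure M ?B"
    using f(1) inc by (intro finite_Lim_measure_incseq) auto
  have meas: "?B \<in> sets M" "?B \<subseteq> A" using f(1) by auto
  have le: "measure M ?B \<le> t"
    using lim f(1) by (intro LIMSEQ_le_const2[OF lim]) auto
  have "measure M ?B = t"
  proof (rule ccontr)
    assume "measure M ?B \<noteq> t"
    then have less: "measure M ?B < t" using le by simp
    have "measure M (A - ?B) = measure M A - measure M ?B"
      using meas A by (intro finite_measure_Diff) auto
    then have "measure M (A - ?B) > 0" using less t by simp
    then obtain C where C: "C \<in> sets M" "C \<subseteq> A - ?B" "0 < measure M C" "measure M C \<le> t - measure M ?B"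
      using nonatomic_small_subset[OF na, of "A - ?B" "t - measure M ?B"] A meas less by auto
    \<comment> \<open>A set that can be added to the limit can be added at every stage, so its
      measure is at most twice each increment, hence 0.\<close>
    have "C \<in> F (f n)" for n
    proof -
      have "measure M (f n) \<le> measure M ?B" using meas by (intro finite_measure_mono) auto
      then show ?thesis using C by (auto simp: F_def)
    qed
    then have "measure M C \<le> 2 * (measure M (f (Suc n)) - measure M (f n))" for n
      using f(2) by blast
    moreover have "(\<lambda>n. 2 * (measure M (f (Suc n)) - measure M (f n))) \<longlonglongrightarrow>
        2 * (measure M ?B - measure M ?B)"
      by (intro tendsto_intros lim LIMSEQ_Suc[OF lim])
    ultimately have "measure M C \<le> 2 * (measure M ?B - measure M ?B)"
      by (intro LIMSEQ_le_const) auto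
    then show False using C by simp
  qed
  then show ?thesis using meas that by blast
qed

section \<open>Cutting into pieces of equal mass\<close>

text \<open>The pieces cover \<open>A\<close> exactly, not just up to a null set. In particular
  \<open>n = 0\<close> forces \<open>A\<close> to be empty, which is why the existence results below
  must secure at least one piece.\<close>

definition cuts :: "'a measure \<Rightarrow> real \<Rightarrow> 'a set \<Rightarrow> nat \<Rightarrow> (nat \<Rightarrow> 'a set) \<Rightarrow> bool" where
  "cuts M c A n P \<longleftrightarrow> disjoint_family_on P {..<n} \<and> (\<Union>i<n. P i) = A \<and>
     (\<forall>i<n. P i \<in> sets M \<and> measure M (P i) = c)"

lemma cuts_append:
  assumes P: "cuts M c A p P" and Q: "cuts M c B q Q" and "A \<inter> B = {}"
  shows "cuts M c (A \<union> B) (p + q) (\<lambda>i. if i < p then P i else Q (i - p))"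
    (is "cuts _ _ _ _ ?R")
proof -
  have sub: "i < p \<Longrightarrow> P i \<subseteq> A" "j < q \<Longrightarrow> Q j \<subseteq> B" for i j
    using P Q by (auto simp: cuts_def)
  have "disjoint_family_on ?R {..<p + q}"
    unfolding disjoint_family_on_def
  proof (intro ballI impI)
    fix i j assume ij: "i \<in> {..<p + q}" "j \<in> {..<p + q}" "i \<noteq> j"
    consider "i < p" "j < p" | "i < p" "\<not> j < p" | "\<not> i < p" "j < p" | "\<not> i < p" "\<not> j < p" by blast
    then show "?R i \<inter> ?R j = {}"
    proof cases
      case 1 then show ?thesis using P ij by (auto simp: cuts_def disjoint_family_on_def)
    next
      case 2
      then have "P i \<subseteq> A" "Q (j - p) \<subseteq> B" using sub ij by auto
      then show ?thesis using 2 assms(3) by auto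
    next
      case 3
      then have "P j \<subseteq> A" "Q (i - p) \<subseteq> B" using sub ij by auto
      then show ?thesis using 3 assms(3) by auto
    next
      case 4
      then have "i - p \<in> {..<q}" "j - p \<in> {..<q}" "i - p \<noteq> j - p" using ij by auto
      then have "Q (i - p) \<inter> Q (j - p) = {}" using Q unfolding cuts_def disjoint_family_on_def by blast
      then show ?thesis using 4 by auto
    qed
  qed
  moreover have "(\<Union>i<p + q. ?R i) = A \<union> B"
  proof
    show "(\<Union>i<p + q. ?R i) \<subseteq> A \<union> B"
      using sub(1) sub(2)[of "_ - p"] by (auto split: if_splits) (metis UnE add_diff_inverse_nat nat_add_left_cancel_less subsetD)
    have "A \<subseteq> (\<Union>i<p + q. ?R i)"
      using P by (fastforce simp: cuts_def)
    moreover have "Q j \<subseteq> (\<Union>i<p + q. ?R i)" if "j < q" for j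
      using that by (intro UN_upper[of "p + j", THEN subset_trans[rotated]]) auto
    ultimately show "A \<union> B \<subseteq> (\<Union>i<p + q. ?R i)"
      using Q by (auto simp: cuts_def)
  qed
  ultimately show ?thesis
    using P Q by (auto simp: cuts_def)
qed

lemma (in finite_measure) nonatomic_cuts:
  assumes na: "nonatomic M" and "c > 0"
  shows "A \<in> sets M \<Longrightarrow> measure M A = real (Suc n) * c \<Longrightarrow> \<exists>P. cuts M c A (Suc n) P"
proof (induction n arbitrary: A)
  case 0
  then have "cuts M c A (Suc 0) (\<lambda>_. A)" by (auto simp: cuts_def disjoint_family_on_def)
  then show ?case by blast
next
  case (Suc n)
  obtain B where B: "B \<in> sets M" "B \<subseteq> A" "measure M B = c"
    using nonatomic_subset_of_measure[OF na Suc.prems(1), of c] Suc.prems \<open>c > 0\<close>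
    by (auto simp: algebra_simps)
  then have "measure M (A - B) = real (Suc n) * c"
    using Suc.prems by (simp add: finite_measure_Diff algebra_simps)
  then obtain P where P: "cuts M c (A - B) (Suc n) P"
    using Suc.IH[of "A - B"] Suc.prems B by auto
  have "cuts M c B 1 (\<lambda>_. B)"
    using B by (auto simp: cuts_def disjoint_family_on_def)
  from cuts_append[OF P this] have "\<exists>R. cuts M c ((A - B) \<union> B) (Suc (Suc n)) R" by auto
  moreover have "(A - B) \<union> B = A" using B by auto
  ultimately show ?case by simp
qed

text \<open>Here \<open>V k\<close> is the original cell of node \<open>k\<close>,
  \<open>T k\<close> its current load including what its children have handed over, and
  \<open>D k\<close> the region allowed for pieces cut there. The induction removes the last node,
  which is a leaf because parents have smaller indices; \<open>T\<close> varies because the parent's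
  load grows, while \<open>V\<close> and \<open>D\<close> stay fixed.\<close>

lemma (in finite_measure) nonatomic_cuts_tree:
  fixes T V D :: "nat \<Rightarrow> 'a set" and parent :: "nat \<Rightarrow> nat"
  assumes na: "nonatomic M" and c: "c > 0"
  shows "\<lbrakk>disjoint_family_on T {..<Suc m};
     \<And>k. k \<le> m \<Longrightarrow> T k \<in> sets M \<and> V k \<in> sets M \<and> V k \<subseteq> T k \<and> T k \<subseteq> D k \<and> c \<le> measure M (V k);
     \<And>k. 0 < k \<Longrightarrow> k \<le> m \<Longrightarrow> parent k < k \<and> V k \<subseteq> D (parent k);
     measure M (\<Union>k<Suc m. T k) = real n * c\<rbrakk>
   \<Longrightarrow> \<exists>P. cuts M c (\<Union>k<Suc m. T k) n P \<and> (\<forall>i<n. \<exists>k\<le>m. P i \<subseteq> D k)"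
proof (induction m arbitrary: T n)
  case 0
  have T0: "T 0 \<in> sets M" "T 0 \<subseteq> D 0" "measure M (T 0) = real n * c"
    using "0.prems"(2)[of 0] "0.prems"(4) by (auto simp: lessThan_Suc)
  have "c \<le> measure M (T 0)"
    using "0.prems"(2)[of 0] finite_measure_mono[of "V 0" "T 0"] by force
  \<comment> \<open>At the root nothing remains to hand on: the load is an exact multiple of
    \<open>c\<close>, and a positive one because it contains \<open>V 0\<close>.\<close>
  then have "n \<noteq> 0" using T0 c by (intro notI) auto
  then obtain n' where "n = Suc n'" using not0_implies_Suc by blast
  then obtain P where P: "cuts M c (T 0) n P"
    using nonatomic_cuts[OF na c, of "T 0" n'] T0 by auto
  then have "\<forall>i<n. P i \<subseteq> D 0" using T0 by (auto simp: cuts_def)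
  moreover have "(\<Union>k<Suc 0. T k) = T 0" by (auto simp: lessThan_Suc)
  ultimately show ?case using P by (intro exI[of _ P]) auto
next
  case (Suc m)
  let ?k = "Suc m" and ?p = "parent (Suc m)"
  have pk: "?p < ?k" "V ?k \<subseteq> D ?p" using Suc.prems(3)[of ?k] by auto
  have Tk: "T ?k \<in> sets M" "V ?k \<in> sets M" "V ?k \<subseteq> T ?k" "T ?k \<subseteq> D ?k" "c \<le> measure M (V ?k)"
    using Suc.prems(2)[of ?k] by auto
  have Tsets: "T j \<in> sets M" if "j \<le> ?k" for j using Suc.prems(2) that by auto
  have disj: "T i \<inter> T j = {}" if "i \<le> ?k" "j \<le> ?k" "i \<noteq> j" for i j
    using disjoint_family_onD[OF Suc.prems(1), of i j] that by auto
  define t where "t = measure M (T ?k)"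
  \<comment> \<open>As many whole pieces as the load permits. The cell alone has mass at least
    \<open>c\<close>, so \<open>q\<close> is at least 1 and a null rest cannot be left without a
    piece.\<close>
  define q where "q = nat \<lfloor>t / c\<rfloor>"
  define r where "r = t - real q * c"
  have "c \<le> t" using Tk finite_measure_mono[of "V ?k" "T ?k"] by (auto simp: t_def)
  then have "1 \<le> t / c" using c by simp
  then have q: "real q \<le> t / c" "t / c < real q + 1" "q \<ge> 1"
    unfolding q_def by (simp_all add: le_nat_iff le_floor_iff)
  then have r: "0 \<le> r" "r < c" using c by (auto simp: r_def field_simps)
  \<comment> \<open>The remainder fits into the cell because \<open>r < c\<close>. Taking it from
    \<open>V ?k\<close> rather than from all of \<open>T ?k\<close> is essential: only the cell is
    known to lie in \<open>D ?p\<close>.\<close>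
  obtain B where B: "B \<in> sets M" "B \<subseteq> V ?k" "measure M B = r"
    using nonatomic_subset_of_measure[OF na Tk(2) r(1)] Tk(5) r by auto
  have BT: "B \<subseteq> T ?k" using B Tk by auto
  have "measure M (T ?k - B) = real q * c"
    using B Tk BT by (simp add: finite_measure_Diff r_def t_def)
  moreover obtain q' where "q = Suc q'" using q(3) by (cases q) auto
  ultimately obtain P where P: "cuts M c (T ?k - B) q P"
    using nonatomic_cuts[OF na c, of "T ?k - B" q'] B Tk by auto
  define T' where "T' = T(?p := T ?p \<union> B)"
  have T'_un: "(\<Union>j<?k. T' j) = (\<Union>j<?k. T j) \<union> B"
    using pk by (auto simp: T'_def split: if_splits)
  have "disjoint_family_on T' {..<?k}"
    unfolding disjoint_family_on_def
  proof (intro ballI impI)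
    fix i j assume ij: "i \<in> {..<?k}" "j \<in> {..<?k}" "i \<noteq> j"
    then show "T' i \<inter> T' j = {}"
      using disj[of i j] disj[of i ?k] disj[of j ?k] BT by (auto simp: T'_def)
  qed
  moreover have "T' k \<in> sets M \<and> V k \<in> sets M \<and> V k \<subseteq> T' k \<and> T' k \<subseteq> D k \<and> c \<le> measure M (V k)"
    if "k \<le> m" for k
    using Suc.prems(2)[of k] that B pk by (auto simp: T'_def)
  moreover have "parent k < k \<and> V k \<subseteq> D (parent k)" if "0 < k" "k \<le> m" for k
    using Suc.prems(3)[of k] that by auto
  moreover have split: "(\<Union>j<Suc ?k. T j) = (\<Union>j<?k. T' j) \<union> (T ?k - B)"
    and dis: "(\<Union>j<?k. T' j) \<inter> (T ?k - B) = {}"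
  proof -
    show "(\<Union>j<Suc ?k. T j) = (\<Union>j<?k. T' j) \<union> (T ?k - B)"
      unfolding T'_un using BT by (auto simp: lessThan_Suc)
    show "(\<Union>j<?k. T' j) \<inter> (T ?k - B) = {}"
    proof -
      have "T i \<inter> T ?k = {}" if "i < ?k" for i using disj[of i ?k] that by simp
      then show ?thesis unfolding T'_un by blast
    qed
  qed
  have T's: "(\<Union>j<?k. T' j) \<in> sets M" unfolding T'_un using B Tsets by auto
  have "real n * c = measure M (\<Union>j<?k. T' j) + real q * c"
    using Suc.prems(4) unfolding split
    using finite_measure_Union[OF T's _ dis] B Tk \<open>measure M (T ?k - B) = real q * c\<close> by auto
  then have m': "measure M (\<Union>j<?k. T' j) = (real n - real q) * c" by (simp add: algebra_simps)
  \<comment> \<open>This sign yields \<open>q \<le> n\<close>, so that the natural-number difference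
    \<open>n - q\<close> is the true number of pieces left for the induction hypothesis.\<close>
  then have "0 \<le> (real n - real q) * c" by (metis measure_nonneg)
  then have "q \<le> n" using c by (simp add: zero_le_mult_iff)
  then have "measure M (\<Union>j<?k. T' j) = real (n - q) * c" using m' by (simp add: of_nat_diff)
  ultimately have "\<exists>P. cuts M c (\<Union>j<?k. T' j) (n - q) P \<and> (\<forall>i<n - q. \<exists>k\<le>m. P i \<subseteq> D k)"
    by (intro Suc.IH) auto
  then obtain Q where Q: "cuts M c (\<Union>j<?k. T' j) (n - q) Q" "\<forall>i<n - q. \<exists>k\<le>m. Q i \<subseteq> D k"
    by blast
  let ?R = "\<lambda>i. if i < n - q then Q i else P (i - (n - q))"
  have "cuts M c (\<Union>j<Suc ?k. T j) n ?R"
    using cuts_append[OF Q(1) P dis] \<open>q \<le> n\<close> unfolding split by simp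
  moreover have "\<exists>k\<le>?k. ?R i \<subseteq> D k" if "i < n" for i
  proof (cases "i < n - q")
    case True
    then obtain k where "k \<le> m" "Q i \<subseteq> D k" using Q(2) by blast
    then show ?thesis using True by (intro exI[of _ k]) auto
  next
    case False
    then have "i - (n - q) < q" using that \<open>q \<le> n\<close> by auto
    then have "P (i - (n - q)) \<subseteq> T ?k - B" using P unfolding cuts_def by blast
    then show ?thesis using False Tk(4) by (intro exI[of _ ?k]) auto
  qed
  ultimately show ?case by blast
qed

section \<open>Greedy separated points in a connected set\<close>

text \<open>There are \<open>m + 1\<close> nodes, with root \<open>x 0\<close>. Equality in the last
  clause provides the tree edges: any such \<open>j\<close> can serve as the parent of
  \<open>k\<close>.\<close>

definition separated_tree :: "'a::metric_space set \<Rightarrow> real \<Rightarrow> nat \<Rightarrow> (nat \<Rightarrow> 'a) \<Rightarrow> bool" where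
  "separated_tree S d m x \<longleftrightarrow> (\<forall>k\<le>m. x k \<in> S) \<and> (\<forall>k\<le>m. \<forall>j<k. d \<le> dist (x j) (x k)) \<and>
     (\<forall>k\<le>m. 0 < k \<longrightarrow> (\<exists>j<k. dist (x j) (x k) = d))"

text \<open>The distance to the finite set of nodes is continuous, vanishes at a node and is at
  least \<open>d\<close> at \<open>y\<close>, so on a connected set it takes the value
  \<open>d\<close> at some \<open>z\<close>. The minimum is attained, and the node attaining it is
  the parent of \<open>z\<close>.\<close>

lemma separated_tree_extend:
  assumes x: "separated_tree S d m x" and S: "connected S" and "d \<ge> 0"
    and y: "y \<in> S" "\<And>k. k \<le> m \<Longrightarrow> d \<le> dist (x k) y"
  shows "\<exists>z. separated_tree S d (Suc m) (x(Suc m := z))"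
proof -
  let ?X = "x ` {..m}"
  have inf: "infdist z ?X = Min ((\<lambda>a. dist z a) ` ?X)" for z
    by (simp add: infdist_notempty cInf_eq_Min)
  have "connected ((\<lambda>z. infdist z ?X) ` S)"
    using S by (intro connected_continuous_image continuous_intros)
  moreover have "0 \<in> (\<lambda>z. infdist z ?X) ` S"
    using x by (intro image_eqI[of _ _ "x 0"]) (auto simp: separated_tree_def)
  moreover have "infdist y ?X \<in> (\<lambda>z. infdist z ?X) ` S" using y by auto
  moreover have "d \<le> infdist y ?X"
    unfolding inf using y by (subst Min_ge_iff) (auto simp: dist_commute)
  ultimately have "d \<in> (\<lambda>z. infdist z ?X) ` S"
    using \<open>d \<ge> 0\<close> by (meson connectedD_interval)
  then obtain z where z: "z \<in> S" "infdist z ?X = d" by auto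
  have "d \<in> (\<lambda>a. dist z a) ` ?X"
    using z(2) Min_in[of "(\<lambda>a. dist z a) ` ?X"] unfolding inf by auto
  then obtain j where j: "j \<le> m" "dist (x j) z = d" by (auto simp: dist_commute)
  have "d \<le> dist (x k) z" if "k \<le> m" for k
    using infdist_le[of "x k" ?X z] z(2) that by (auto simp: dist_commute)
  then have "separated_tree S d (Suc m) (x(Suc m := z))"
    unfolding separated_tree_def
  proof (intro conjI allI impI)
    fix k assume k: "k \<le> Suc m"
    show "(x(Suc m := z)) k \<in> S"
      using x z(1) k by (auto simp: separated_tree_def)
    show "d \<le> dist ((x(Suc m := z)) i) ((x(Suc m := z)) k)" if "i < k" for i
      using x k that \<open>\<And>k. k \<le> m \<Longrightarrow> d \<le> dist (x k) z\<close>
      by (cases "k = Suc m") (auto simp: separated_tree_def)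
    show "\<exists>i<k. dist ((x(Suc m := z)) i) ((x(Suc m := z)) k) = d" if pos: "0 < k"
    proof (cases "k = Suc m")
      case True then show ?thesis using j by (intro exI[of _ j]) auto
    next
      case False
      then obtain i where "i < k" "dist (x i) (x k) = d"
        using x k pos by (auto simp: separated_tree_def le_Suc_eq)
      then show ?thesis using False k by (intro exI[of _ i]) auto
    qed
  qed
  then show ?thesis by blast
qed

text \<open>The bound \<open>b\<close> yields a largest tree; a point outside all its balls would
  let it grow.\<close>

lemma separated_tree_maximal:
  assumes S: "connected S" "S \<noteq> {}" and "d \<ge> 0"
    and bound: "\<And>m x. separated_tree S d m x \<Longrightarrow> m \<le> b"
  obtains m x where "separated_tree S d m x" "S \<subseteq> (\<Union>k\<le>m. ball (x k) d)"
proof -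
  define P where "P m \<longleftrightarrow> (\<exists>x. separated_tree S d m x)" for m
  obtain s where "s \<in> S" using S by blast
  then have "separated_tree S d 0 (\<lambda>_. s)" by (auto simp: separated_tree_def)
  then have P0: "P 0" unfolding P_def by blast
  have Pb: "\<And>m. P m \<Longrightarrow> m \<le> b" using bound unfolding P_def by blast
  obtain m where m: "P m" "\<And>k. P k \<Longrightarrow> k \<le> m"
    using GreatestI_nat[of P, OF P0 Pb] Greatest_le_nat[of P, OF _ Pb] by blast
  then obtain x where x: "separated_tree S d m x" unfolding P_def by blast
  have "S \<subseteq> (\<Union>k\<le>m. ball (x k) d)"
  proof (rule ccontr)
    assume "\<not> ?thesis"
    then obtain y where y: "y \<in> S" "\<And>k. k \<le> m \<Longrightarrow> d \<le> dist (x k) y" by (force simp: not_less)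
    from separated_tree_extend[OF x S(1) \<open>d \<ge> 0\<close> y] have "P (Suc m)" unfolding P_def by blast
    then show False using m(2) by force
  qed
  then show ?thesis using x that by blast
qed

lemma separated_balls_disjoint:
  assumes "separated_tree S d m x"
  shows "disjoint_family_on (\<lambda>k. rel_ball S (x k) (d / 2)) {..m}"
  unfolding disjoint_family_on_def
proof (intro ballI impI)
  fix i j assume ij: "i \<in> {..m}" "j \<in> {..m}" "i \<noteq> j"
  then have "d \<le> dist (x i) (x j)"
    using assms unfolding separated_tree_def by (cases i j rule: linorder_cases) (auto simp: dist_commute)
  moreover have "dist (x i) (x j) < d" if "y \<in> rel_ball S (x i) (d / 2)" "y \<in> rel_ball S (x j) (d / 2)" for y
    using that dist_triangle2[of "x i" "x j" y] by (auto simp: rel_ball_def)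
  ultimately show "rel_ball S (x i) (d / 2) \<inter> rel_ball S (x j) (d / 2) = {}" by fastforce
qed

section \<open>Cells around the nodes and the final partition\<close>

theorem theorem4p1:
  fixes \<Omega> :: "'a::metric_space set" and \<mu> :: "'a measure" and N :: nat and \<delta> :: real
  assumes "compact \<Omega>" and "path_connected \<Omega>" and "diameter \<Omega> = pi"
    and "sets \<mu> = sets (restrict_space borel \<Omega>)" and "prob_space \<mu>" and "nonatomic \<mu>"
    and "N \<ge> 2" and "\<delta> > 0"
    and "(INF x\<in>\<Omega>. measure \<mu> (rel_ball \<Omega> x (\<delta> / 2))) \<ge> 1 / real N"
  shows "\<exists>R :: nat \<Rightarrow> 'a set.
           measurable_partition \<mu> {1..N} R \<and>
           (\<forall>j\<in>{1..N}. measure \<mu> (R j) = 1 / real N \<and> diameter (R j) \<le> 4 * \<delta>)"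
proof -
  interpret prob_space \<mu> by fact
  let ?c = "1 / real N"
  have c: "?c > 0" using assms(7) by simp
  have space: "space \<mu> = \<Omega>"
    using sets_eq_imp_space_eq[OF assms(4)] by (simp add: space_restrict_space)
  \<comment> \<open>The diameter of the empty set is 0 by convention, which differs from
    \<open>pi\<close>.\<close>
  have ne: "\<Omega> \<noteq> {}" using assms(3) by auto
  have ball_sets: "rel_ball \<Omega> x r \<in> sets \<mu>" for x r
  proof -
    have "rel_ball \<Omega> x r = \<Omega> \<inter> ball x r" by (auto simp: rel_ball_def)
    then show ?thesis unfolding assms(4) sets_restrict_space by auto
  qed
  have mass: "?c \<le> measure \<mu> (rel_ball \<Omega> x (\<delta> / 2))" if "x \<in> \<Omega>" for x
  proof -
    have "(INF x\<in>\<Omega>. measure \<mu> (rel_ball \<Omega> x (\<delta> / 2))) \<le> measure \<mu> (rel_ball \<Omega> x (\<delta> / 2))"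
      using that by (intro cINF_lower bdd_belowI2[where m = 0]) auto
    then show ?thesis using assms(9) by linarith
  qed
  \<comment> \<open>The \<open>Suc m\<close> balls of radius \<delta>/2 are disjoint, each of mass
    at least \<open>?c\<close>, and the total mass is at most 1; hence the greedy choice must
    stop.\<close>
  have "m \<le> N" if x: "separated_tree \<Omega> \<delta> m x" for m x
  proof -
    have "real (Suc m) * ?c \<le> (\<Sum>k\<le>m. measure \<mu> (rel_ball \<Omega> (x k) (\<delta> / 2)))"
      using sum_mono[of "{..m}" "\<lambda>_. ?c" "\<lambda>k. measure \<mu> (rel_ball \<Omega> (x k) (\<delta> / 2))"]
        mass x by (auto simp: separated_tree_def)
    also have "\<dots> = measure \<mu> (\<Union>k\<le>m. rel_ball \<Omega> (x k) (\<delta> / 2))"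
      using separated_balls_disjoint[OF x] ball_sets
      by (intro finite_measure_finite_Union[symmetric]) auto
    also have "\<dots> \<le> 1" by simp
    finally show ?thesis using assms(7) by (simp add: field_simps)
  qed
  then obtain m x where x: "separated_tree \<Omega> \<delta> m x" and cover: "\<Omega> \<subseteq> (\<Union>k\<le>m. ball (x k) \<delta>)"
    using separated_tree_maximal[of \<Omega> \<delta> N] ne assms(8) path_connected_imp_connected[OF assms(2)]
    by (metis less_imp_le)
  define H where "H = (\<Union>k\<le>m. rel_ball \<Omega> (x k) (\<delta> / 2))"
  \<comment> \<open>Each node keeps its own small ball, which secures the mass. Points outside all
    small balls go to the first \<delta>-ball containing them.\<close>
  define V where "V k = rel_ball \<Omega> (x k) (\<delta> / 2) \<union>
      (rel_ball \<Omega> (x k) \<delta> - H - (\<Union>j<k. rel_ball \<Omega> (x j) \<delta>))" for k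
  \<comment> \<open>The radius is \<delta> for the cell plus \<delta> for the edge to the parent; it
    makes the final diameter at most 4\<delta>.\<close>
  define D where "D k = cball (x k) (2 * \<delta>)" for k
  have V_sub: "V k \<subseteq> rel_ball \<Omega> (x k) \<delta>" for k
    using assms(8) by (auto simp: V_def rel_ball_def)
  have V_sets: "V k \<in> sets \<mu>" for k
    unfolding V_def H_def using ball_sets by auto
  have V_mass: "?c \<le> measure \<mu> (V k)" if "k \<le> m" for k
  proof -
    have "?c \<le> measure \<mu> (rel_ball \<Omega> (x k) (\<delta> / 2))"
      using mass x that by (auto simp: separated_tree_def)
    also have "\<dots> \<le> measure \<mu> (V k)"
      using V_sets by (intro finite_measure_mono) (auto simp: V_def)
    finally show ?thesis .
  qed
  have V_disj: "V i \<inter> V j = {}" if "i < j" "j \<le> m" for i j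
  proof -
    have "rel_ball \<Omega> (x i) (\<delta> / 2) \<inter> rel_ball \<Omega> (x j) (\<delta> / 2) = {}"
      using disjoint_family_onD[OF separated_balls_disjoint[OF x], of i j] that by auto
    moreover have "rel_ball \<Omega> (x i) (\<delta> / 2) \<subseteq> H" "rel_ball \<Omega> (x j) (\<delta> / 2) \<subseteq> H"
      using that UN_upper[of i "{..m}" "\<lambda>k. rel_ball \<Omega> (x k) (\<delta> / 2)"]
        UN_upper[of j "{..m}" "\<lambda>k. rel_ball \<Omega> (x k) (\<delta> / 2)"]
      by (simp_all add: H_def)
    ultimately show ?thesis using that by (auto simp: V_def)
  qed
  have V_disjoint: "disjoint_family_on V {..<Suc m}"
    unfolding disjoint_family_on_def
  proof (intro ballI impI)
    fix i j assume "i \<in> {..<Suc m}" "j \<in> {..<Suc m}" "i \<noteq> j"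
    then show "V i \<inter> V j = {}"
      using V_disj[of i j] V_disj[of j i] by (cases i j rule: linorder_cases) auto
  qed
  have V_cover: "(\<Union>k<Suc m. V k) = \<Omega>"
  proof
    show "(\<Union>k<Suc m. V k) \<subseteq> \<Omega>" using V_sub by (fastforce simp: rel_ball_def)
    show "\<Omega> \<subseteq> (\<Union>k<Suc m. V k)"
    proof
      fix y assume y: "y \<in> \<Omega>"
      show "y \<in> (\<Union>k<Suc m. V k)"
      proof (cases "y \<in> H")
        case True then show ?thesis by (auto simp: H_def V_def less_Suc_eq_le)
      next
        case False
        \<comment> \<open>The least index is sought among all naturals; the witness \<open>l\<close>
          from the cover keeps it at most \<open>m\<close>.\<close>
        define k where "k = (LEAST k. y \<in> rel_ball \<Omega> (x k) \<delta>)"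
        obtain l where l: "l \<le> m" "y \<in> rel_ball \<Omega> (x l) \<delta>"
          using cover y by (auto simp: rel_ball_def)
        then have "k \<le> m" "y \<in> rel_ball \<Omega> (x k) \<delta>"
          unfolding k_def by (auto intro: LeastI order_trans[OF Least_le])
        moreover have "y \<notin> rel_ball \<Omega> (x j) \<delta>" if "j < k" for j
          using not_less_Least that unfolding k_def by blast
        ultimately show ?thesis using False by (auto simp: V_def less_Suc_eq_le)
      qed
    qed
  qed
  have "\<exists>p. \<forall>k. 0 < k \<and> k \<le> m \<longrightarrow> p k < k \<and> dist (x (p k)) (x k) = \<delta>"
    using x unfolding separated_tree_def by (intro choice) blast
  then obtain parent where parent:
    "\<And>k. 0 < k \<Longrightarrow> k \<le> m \<Longrightarrow> parent k < k \<and> dist (x (parent k)) (x k) = \<delta>" by blast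
  have V_parent: "V k \<subseteq> D (parent k)" if "0 < k" "k \<le> m" for k
  proof
    fix y assume "y \<in> V k"
    then have "dist (x k) y < \<delta>" using V_sub by (auto simp: rel_ball_def)
    then show "y \<in> D (parent k)"
      using parent[OF that] dist_triangle[of "x (parent k)" y "x k"] by (simp add: D_def)
  qed
  have V_D: "V k \<subseteq> D k" for k
  proof
    fix y assume "y \<in> V k"
    then have "dist (x k) y < \<delta>" using V_sub by (auto simp: rel_ball_def)
    then show "y \<in> D k" using assms(8) by (simp add: D_def)
  qed
  have "measure \<mu> (\<Union>k<Suc m. V k) = real N * ?c"
    unfolding V_cover using prob_space space assms(7) by simp
  \<comment> \<open>Before any remainder is handed on, each load is just the cell, so
    \<open>V\<close> is used for both \<open>T\<close> and \<open>V\<close>.\<close>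
  then obtain P where P: "cuts \<mu> ?c \<Omega> N P" and PD: "\<And>i. i < N \<Longrightarrow> \<exists>k\<le>m. P i \<subseteq> D k"
    using nonatomic_cuts_tree[OF assms(6) c V_disjoint, of V D parent N]
      V_sets V_D V_mass parent V_parent unfolding V_cover by auto
  define R where "R j = P (j - 1)" for j
  have "disjoint_family_on R {1..N}"
    unfolding disjoint_family_on_def
  proof (intro ballI impI)
    fix i j assume "i \<in> {1..N}" "j \<in> {1..N}" "i \<noteq> j"
    then have "i - 1 \<in> {..<N}" "j - 1 \<in> {..<N}" "i - 1 \<noteq> j - 1" by auto
    then show "R i \<inter> R j = {}" using P unfolding R_def cuts_def disjoint_family_on_def by blast
  qed
  moreover have "(\<Union>j\<in>{1..N}. R j) = \<Omega>"
  proof -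
    have "R ` {1..N} = P ` {..<N}"
      unfolding image_Suc_lessThan[symmetric] image_image R_def by simp
    then show ?thesis using P unfolding cuts_def by simp
  qed
  moreover have piece: "R j \<in> sets \<mu>" "measure \<mu> (R j) = ?c" "diameter (R j) \<le> 4 * \<delta>"
    if "j \<in> {1..N}" for j
  proof -
    have j: "j - 1 < N" using that by auto
    then show "R j \<in> sets \<mu>" "measure \<mu> (R j) = ?c"
      using P by (auto simp: R_def cuts_def)
    obtain k where "R j \<subseteq> cball (x k) (2 * \<delta>)"
      using PD[OF j] by (auto simp: R_def D_def)
    then have near: "dist (x k) y \<le> 2 * \<delta>" if "y \<in> R j" for y
      using that by auto
    have "dist y z \<le> 4 * \<delta>" if "y \<in> R j" "z \<in> R j" for y z
      using near[OF that(1)] near[OF that(2)] dist_triangle3[of y z "x k"] by simp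
    \<comment> \<open>The definition of \<open>diameter\<close> treats the empty set separately,
      with value 0; positivity of \<delta> settles that case.\<close>
    then show "diameter (R j) \<le> 4 * \<delta>"
      using assms(8) by (auto simp: diameter_def intro!: cSUP_least)
  qed
  ultimately have "measurable_partition \<mu> {1..N} R"
    unfolding measurable_partition_def space by auto
  then show ?thesis using piece by blast
qed

end
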